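(* Let $X\subset\mathbb{R}^s$ be open, let $C\subset\mathbb{R}^n$, $K\subset\mathbb{R}^m$ be closed convex pointed cones with vertex at the origin, with $\operatorname{int}(C)\neq\emptyset$, and let $f:X\to\mathbb{R}^n$ and $g:X\to\mathbb{R}^m$ be Fréchet differentiable, with $f$ pseudoconvex with respect to the cone $C$. Let $\bar x\in X$ be feasible, i.e. $g(\bar x)\in -K$. Suppose that there exists a pair $(\lambda,\mu)\in C^*\times K^*$ such that $(\lambda,\mu)\neq(0,0)$ and $$\lambda\nabla f(\bar x)+\mu\nabla g(\bar x)=0.$$ Suppose also that $\mu\cdot g(\bar x)=0$ and that, if $\mu\neq0$, the scalar function $x\mapsto\mu\cdot g(x)$ is strictly pseudoconvex. Then $\bar x$ is a weakly efficient global solution of the problem (P): minimize $f(x)$ with respect to the cone $C$ subject to $g(x)\in -K$.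
   Context: The feasible set is $S=\{x\in X : g(x)\in -K\}$. A feasible point $\bar x\in S$ is a weakly efficient global solution of (P) if there is no other feasible point $x\in S$ with $f(x)\in f(\bar x)-\operatorname{int}(C)$. The positive polar cone is $C^*=\{\lambda\in\mathbb{R}^n : \lambda\cdot x\ge 0 \text{ for all } x\in C\}$, and similarly $K^*\subset\mathbb{R}^m$. Here $\lambda\nabla f(\bar x)=\sum_i\lambda_i\nabla f_i(\bar x)$, and similarly for $\mu\nabla g(\bar x)$. A Fréchet differentiable function $f:X\to\mathbb{R}^n$ is pseudoconvex with respect to $C$ if for all $x,y\in X$: $f(x)\in f(y)-\operatorname{int}(C)$ implies $\nabla f(y)(x-y)\in-\operatorname{int}(C)$. A Fréchet differentiable function $h:X\to\mathbb{R}$ is strictly pseudoconvex if for all $x,y\in X$ with $x\neq y$: $h(x)\le h(y)$ implies $\nabla h(y)(x-y)<0$. *)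

theory Defs
  imports "HOL-Analysis.Analysis"
begin

text \<open>
  A map on an open set \<open>X\<close> is represented by a total function of which only the values on \<open>X\<close>
  matter: on an open \<open>X\<close>, differentiability and derivatives at points of \<open>X\<close> depend only on
  the values there. For \<open>r \<in> \<real>\<^sup>n\<close>, the vector \<open>\<Sum>i. r\<^sub>i \<nabla>f\<^sub>i(x)\<close> is \<open>r v* jacobian f (at x)\<close>,
  since the rows of the Jacobian matrix are the gradients of the components.
\<close>

definition closed_convex_pointed_cone :: "'a::real_normed_vector set \<Rightarrow> bool" where
  "closed_convex_pointed_cone C \<longleftrightarrow> closed C \<and> convex_cone C \<and> C \<inter> uminus ` C = {0}"

definition positive_polar :: "'a::real_inner set \<Rightarrow> 'a set" where
  "positive_polar C = {l. \<forall>x\<in>C. 0 \<le> l \<bullet> x}"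

definition feasible_set :: "'a set \<Rightarrow> ('a \<Rightarrow> 'b::real_normed_vector) \<Rightarrow> 'b set \<Rightarrow> 'a set" where
  "feasible_set X g K = {x \<in> X. g x \<in> uminus ` K}"

definition weakly_efficient ::
    "'a set \<Rightarrow> ('a \<Rightarrow> 'b::real_normed_vector) \<Rightarrow> 'b set \<Rightarrow>
     ('a \<Rightarrow> 'c::real_normed_vector) \<Rightarrow> 'c set \<Rightarrow> 'a \<Rightarrow> bool" where
  "weakly_efficient X f C g K xbar \<longleftrightarrow>
     xbar \<in> feasible_set X g K \<and>
     \<not> (\<exists>x \<in> feasible_set X g K. x \<noteq> xbar \<and> f x \<in> (\<lambda>c. f xbar - c) ` interior C)"

definition pseudoconvex_wrt ::
    "'a::real_normed_vector set \<Rightarrow> 'b::real_normed_vector set \<Rightarrow> ('a \<Rightarrow> 'b) \<Rightarrow> bool" where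
  "pseudoconvex_wrt X C f \<longleftrightarrow>
     (\<forall>x\<in>X. f differentiable (at x)) \<and>
     (\<forall>x\<in>X. \<forall>y\<in>X. f x \<in> (\<lambda>c. f y - c) ` interior C \<longrightarrow>
        frechet_derivative f (at y) (x - y) \<in> uminus ` interior C)"

definition strictly_pseudoconvex :: "'a::real_normed_vector set \<Rightarrow> ('a \<Rightarrow> real) \<Rightarrow> bool" where
  "strictly_pseudoconvex X h \<longleftrightarrow>
     (\<forall>x\<in>X. h differentiable (at x)) \<and>
     (\<forall>x\<in>X. \<forall>y\<in>X. x \<noteq> y \<longrightarrow> h x \<le> h y \<longrightarrow> frechet_derivative h (at y) (x - y) < 0)"

end

theory Submission
  imports Defs
begin

text \<open>
  Suppose a feasible point \<open>x\<close> beats \<open>xbar\<close> and put \<open>v = x - xbar\<close>. By pseudoconvexity the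
  derivative \<open>Df\<close> at \<open>xbar\<close> maps \<open>v\<close> into \<open>- interior C\<close>, and a nonzero \<open>l\<close> in the polar of \<open>C\<close> is strictly positive on \<open>interior C\<close>
  (\<open>positive_polar_interior_pos\<close>). So \<open>l \<bullet> Df(v) \<le> 0\<close>, with strict inequality if \<open>l \<noteq> 0\<close>.
  Feasibility and complementarity give \<open>\<mu> \<bullet> g x \<le> 0 = \<mu> \<bullet> g xbar\<close>, and strict pseudoconvexity turns
  this weak inequality into \<open>\<mu> \<bullet> Dg(v) < 0\<close> if \<open>\<mu> \<noteq> 0\<close>. As one of the multipliers is
  nonzero, \<open>l \<bullet> Df(v) + \<mu> \<bullet> Dg(v) < 0\<close>, although stationarity says that this sum is \<open>0\<close>. When
  \<open>l = 0\<close>, the strict inequality comes from the constraint term alone; this is why \<open>\<mu> \<bullet> g\<close> is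
  assumed strictly pseudoconvex.
\<close>

text \<open>
  If \<open>l\<close> vanished at an interior point \<open>c\<close>, a small move from \<open>c\<close> in the direction \<open>- l\<close> would
  stay in \<open>C\<close> and make \<open>l\<close> negative.
\<close>

lemma positive_polar_interior_pos:
  fixes C :: "'a::real_inner set"
  assumes "l \<in> positive_polar C" "l \<noteq> 0" "c \<in> interior C"
  shows "0 < l \<bullet> c"
proof -
  obtain e where "e > 0" and e: "cball c e \<subseteq> C"
    using assms(3) unfolding mem_interior_cball by blast
  have "c - (e / norm l) *\<^sub>R l \<in> cball c e"
    using \<open>e > 0\<close> \<open>l \<noteq> 0\<close> by (simp add: dist_norm)
  then have "0 \<le> l \<bullet> (c - (e / norm l) *\<^sub>R l)"
    using e assms(1) unfolding positive_polar_def by blast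
  moreover have "0 < (e / norm l) * (l \<bullet> l)"
    using \<open>e > 0\<close> \<open>l \<noteq> 0\<close> by simp
  ultimately show ?thesis
    by (simp add: inner_diff_right)
qed

lemma vector_matrix_jacobian_inner:
  fixes f :: "real ^ 'a \<Rightarrow> real ^ 'b"
  assumes "f differentiable (at x)"
  shows "(l v* jacobian f (at x)) \<bullet> h = l \<bullet> frechet_derivative f (at x) h"
proof -
  have "(f has_derivative (\<lambda>h. jacobian f (at x) *v h)) (at x)"
    using assms jacobian_works by blast
  then have "frechet_derivative f (at x) = (\<lambda>h. jacobian f (at x) *v h)"
    by (metis frechet_derivative_at)
  then show ?thesis
    by (simp add: dot_lmul_matrix)
qed

lemma frechet_derivative_inner_left:
  fixes g :: "'a::real_normed_vector \<Rightarrow> 'b::real_inner"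
  assumes "g differentiable (at x)"
  shows "frechet_derivative (\<lambda>x. u \<bullet> g x) (at x) h = u \<bullet> frechet_derivative g (at x) h"
proof -
  have "((\<lambda>x. u \<bullet> g x) has_derivative (\<lambda>h. u \<bullet> frechet_derivative g (at x) h)) (at x)"
    using assms frechet_derivative_works by (blast intro: has_derivative_inner_right)
  then show ?thesis
    by (metis frechet_derivative_at)
qed

theorem theorem5:
  fixes X :: "(real ^ 's) set"
    and C :: "(real ^ 'n) set" and K :: "(real ^ 'm) set"
    and f :: "real ^ 's \<Rightarrow> real ^ 'n" and g :: "real ^ 's \<Rightarrow> real ^ 'm"
    and xbar :: "real ^ 's"
  assumes "open X"
    and "closed_convex_pointed_cone C" and "closed_convex_pointed_cone K"
    and "interior C \<noteq> {}"
    and "\<forall>x\<in>X. f differentiable (at x)" and "\<forall>x\<in>X. g differentiable (at x)"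
    and "pseudoconvex_wrt X C f"
    and "xbar \<in> feasible_set X g K"
    and "\<exists>l \<in> positive_polar C. \<exists>\<mu> \<in> positive_polar K.
           (l, \<mu>) \<noteq> (0, 0) \<and>
           l v* jacobian f (at xbar) + \<mu> v* jacobian g (at xbar) = 0 \<and>
           \<mu> \<bullet> g xbar = 0 \<and>
           (\<mu> \<noteq> 0 \<longrightarrow> strictly_pseudoconvex X (\<lambda>x. \<mu> \<bullet> g x))"
  shows "weakly_efficient X f C g K xbar"
proof -
  obtain l \<mu> where l: "l \<in> positive_polar C" and \<mu>: "\<mu> \<in> positive_polar K"
    and nonzero: "(l, \<mu>) \<noteq> (0, 0)"
    and stationary: "l v* jacobian f (at xbar) + \<mu> v* jacobian g (at xbar) = 0"
    and complementary: "\<mu> \<bullet> g xbar = 0"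
    and strict: "\<mu> \<noteq> 0 \<longrightarrow> strictly_pseudoconvex X (\<lambda>x. \<mu> \<bullet> g x)"
    using assms(9) by blast
  have xbar: "xbar \<in> X"
    using assms(8) by (simp add: feasible_set_def)
  have False
    if x: "x \<in> feasible_set X g K" "x \<noteq> xbar" "f x \<in> (\<lambda>c. f xbar - c) ` interior C" for x
  proof -
    define v where "v = x - xbar"
    have xX: "x \<in> X" and gx: "g x \<in> uminus ` K"
      using x(1) by (auto simp: feasible_set_def)
    have sum: "l \<bullet> frechet_derivative f (at xbar) v + \<mu> \<bullet> frechet_derivative g (at xbar) v = 0"
      using arg_cong[OF stationary, of "\<lambda>w. w \<bullet> v"] xbar assms(5,6)
      by (simp add: inner_add_left vector_matrix_jacobian_inner)
    have "frechet_derivative f (at xbar) v \<in> uminus ` interior C"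
      using assms(7) xX xbar x(3) unfolding pseudoconvex_wrt_def v_def by blast
    then have f_neg: "l \<bullet> frechet_derivative f (at xbar) v < 0" if "l \<noteq> 0"
      using positive_polar_interior_pos[OF l that] by auto
    have "\<mu> \<bullet> g x \<le> \<mu> \<bullet> g xbar"
      using gx \<mu> complementary by (auto simp: positive_polar_def)
    then have "frechet_derivative (\<lambda>x. \<mu> \<bullet> g x) (at xbar) v < 0" if "\<mu> \<noteq> 0"
      using strict that xX xbar x(2) unfolding strictly_pseudoconvex_def v_def by blast
    then have g_neg: "\<mu> \<bullet> frechet_derivative g (at xbar) v < 0" if "\<mu> \<noteq> 0"
      using that xbar assms(6) by (simp add: frechet_derivative_inner_left)
    show False
      using sum f_neg g_neg nonzero by (cases "l = 0"; cases "\<mu> = 0") auto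
  qed
  then show ?thesis
    using assms(8) unfolding weakly_efficient_def by blast
qed

end
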